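(* Let $m\ge 1$ and let $\hat n=\hat n\big((x_A^k,x_B^k)_{k=1}^m\big)$ be an unbiased estimator of $n=|A\cap B|$ based on the $m$ pairs of maximal hash values of $A$ and $B$; that is, in the statistical model $(P_\theta^{\otimes m})_{\theta\in\Theta}$ described in the context, $\mathbb{E}_\theta[\hat n]=n$ for every $\theta=(a,b,n)\in\Theta$. Then for every $\theta=(a,b,n)\in\Theta$, $$\operatorname{Var}_\theta[\hat n]\ \ge\ (\mathbb{F}^{-1})_{3,3},$$ where $\mathbb{F}=\mathbb{F}(a,b,n)$ is the Fisher information matrix of the model and $$(\mathbb{F}^{-1})_{3,3}=\frac{n u}{m}\cdot\frac{(b^2+\alpha\beta)(a^2+\alpha\beta)}{\alpha n(a^2+\alpha\beta)+\beta n(b^2+\alpha\beta)+(a^2+\alpha\beta)(b^2+\alpha\beta)},$$ with $\alpha=a-n$, $\beta=b-n$, $u=a+b-n$.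
   Context: Setting. For finite sets $A,B$ put $n=|A\cap B|$, $u=|A\cup B|$, $a=|A|$, $b=|B|$, $\alpha=|A\setminus B|=a-n$, $\beta=|B\setminus A|=b-n$, so $u=a+b-n$. There are $m$ independent hash functions $h_1,\dots,h_m$, each assigning i.i.d. uniform $U(0,1)$ values to the elements of $A\cup B$; $x_A^k=\max_{e\in A}h_k(e)$ and $x_B^k=\max_{e\in B}h_k(e)$. Statistical model. The parameters are treated as real: $\Theta=\{\theta=(a,b,n)\in\mathbb{R}^3:\ n>0,\ a>n,\ b>n\}$. For $\theta\in\Theta$, $P_\theta$ is the law of a pair $(x_A,x_B)\in(0,1)^2$ with the following density $L(s,t;\theta)$ with respect to the reference measure $\lambda_2+\delta$, where $\lambda_2$ is Lebesgue measure on $(0,1)^2$ and $\delta$ is the image of Lebesgue measure on $(0,1)$ under $s\mapsto(s,s)$: $$L(s,t;\theta)=\begin{cases} n s^{u-1} & s=t,\\ \beta t^{\beta-1}\,a s^{a-1} & s<t,\\ \alpha s^{\alpha-1}\,b t^{b-1} & s>t.\end{cases}$$ The observation consists of $m$ i.i.d. pairs $(x_A^k,x_B^k)\sim P_\theta$. Fisher information matrix. With $(\theta_1,\theta_2,\theta_3)=(a,b,n)$, $\mathbb{F}_{i,j}=-\mathbb{E}_\theta\Big[\frac{\partial^2}{\partial\theta_i\partial\theta_j}\log\prod_{k=1}^m L(x_A^k,x_B^k;\theta)\Big]$ for $1\le i,j\le 3$. *)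

theory Defs
  imports "HOL-Probability.Probability"
begin

definition add_measure :: "'a measure \<Rightarrow> 'a measure \<Rightarrow> 'a measure" where
  "add_measure M N = measure_of (space M) (sets M) (\<lambda>A. emeasure M A + emeasure N A)"

lemma space_add_measure [simp]: "space (add_measure M N) = space M"
  and sets_add_measure [simp, measurable_cong]: "sets (add_measure M N) = sets M"
  by (simp_all add: add_measure_def)

lemma emeasure_add_measure:
  assumes N: "sets N = sets M" and A: "A \<in> sets M"
  shows "emeasure (add_measure M N) A = emeasure M A + emeasure N A"
  unfolding add_measure_def
proof (rule emeasure_measure_of_sigma[OF sets.sigma_algebra_axioms _ _ A])
  show "positive (sets M) (\<lambda>A. emeasure M A + emeasure N A)"
    by (simp add: positive_def)
  show "countably_additive (sets M) (\<lambda>A. emeasure M A + emeasure N A)"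
  proof (rule countably_additiveI)
    fix F :: "nat \<Rightarrow> _"
    assume "range F \<subseteq> sets M" "disjoint_family F" "(\<Union>i. F i) \<in> sets M"
    then show "(\<Sum>i. emeasure M (F i) + emeasure N (F i)) = emeasure M (\<Union>i. F i) + emeasure N (\<Union>i. F i)"
      by (subst suminf_add[symmetric]) (simp_all add: suminf_emeasure N)
  qed
qed

definition unit_square :: "(real \<times> real) set" where
  "unit_square = {0<..<1} \<times> {0<..<1}"

definition diag_measure :: "(real \<times> real) measure" where
  "diag_measure =
     distr (restrict_space lborel {0<..<1}) (restrict_space borel unit_square) (\<lambda>s. (s, s))"

definition ref_measure :: "(real \<times> real) measure" where
  "ref_measure = add_measure (restrict_space lborel unit_square) diag_measure"

lemma sets_diag_measure: "sets diag_measure = sets (restrict_space lborel unit_square)"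
  by (simp add: diag_measure_def sets_restrict_space)

lemma diag_measurable:
  "(\<lambda>s. (s, s)) \<in> measurable (restrict_space lborel {0<..<1::real}) (restrict_space borel unit_square)"
proof (rule measurable_restrict_space2)
  show "(\<lambda>s. (s, s)) \<in> space (restrict_space lborel {0<..<1::real}) \<rightarrow> unit_square"
    by (auto simp: unit_square_def space_restrict_space)
  have "(\<lambda>s::real. (s, s)) \<in> borel_measurable borel"
    by (intro borel_measurable_continuous_onI continuous_intros)
  then show "(\<lambda>s. (s, s)) \<in> borel_measurable (restrict_space lborel {0<..<1::real})"
    by (simp add: measurable_restrict_space1)
qed

text \<open>A parameter \<open>\<theta> = (a, b, n)\<close> is a vector whose components
  \<open>\<theta> $ 1\<close>, \<open>\<theta> $ 2\<close>, \<open>\<theta> $ 3\<close> are \<open>a\<close>, \<open>b\<close>, \<open>n\<close>.\<close>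

definition Theta :: "(real ^ 3) set" where
  "Theta = {\<theta>. \<theta> $ 3 > 0 \<and> \<theta> $ 1 > \<theta> $ 3 \<and> \<theta> $ 2 > \<theta> $ 3}"

definition L :: "real ^ 3 \<Rightarrow> real \<times> real \<Rightarrow> real" where
  "L \<theta> = (\<lambda>(s, t).
     let a = \<theta> $ 1; b = \<theta> $ 2; n = \<theta> $ 3; \<alpha> = a - n; \<beta> = b - n; u = a + b - n in
       if s = t then n * s powr (u - 1)
       else if s < t then \<beta> * t powr (\<beta> - 1) * (a * s powr (a - 1))
       else \<alpha> * s powr (\<alpha> - 1) * (b * t powr (b - 1)))"

definition P :: "real ^ 3 \<Rightarrow> (real \<times> real) measure" where
  "P \<theta> = density ref_measure (\<lambda>x. ennreal (L \<theta> x))"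

definition model :: "nat \<Rightarrow> real ^ 3 \<Rightarrow> (nat \<Rightarrow> real \<times> real) measure" where
  "model m \<theta> = Pi\<^sub>M {1..m} (\<lambda>_. P \<theta>)"

definition partial_deriv :: "'d::finite \<Rightarrow> (real ^ 'd \<Rightarrow> real) \<Rightarrow> real ^ 'd \<Rightarrow> real" where
  "partial_deriv i f \<theta> = deriv (\<lambda>z. f (\<chi> k. if k = i then z else \<theta> $ k)) (\<theta> $ i)"

definition fisher :: "nat \<Rightarrow> real ^ 3 \<Rightarrow> real ^ 3 ^ 3" where
  "fisher m \<theta> = (\<chi> i j. - (\<integral>x. partial_deriv i (partial_deriv j
     (\<lambda>\<theta>'. ln (\<Prod>k\<in>{1..m}. L \<theta>' (x k)))) \<theta> \<partial>(model m \<theta>)))"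

text \<open>An estimator is any measurable function of the observation; all \<open>P \<theta>\<close> have
  the \<open>\<sigma>\<close>-algebra of \<open>ref_measure\<close>.\<close>

definition estimator :: "nat \<Rightarrow> ((nat \<Rightarrow> real \<times> real) \<Rightarrow> real) \<Rightarrow> bool" where
  "estimator m T \<longleftrightarrow> T \<in> borel_measurable (Pi\<^sub>M {1..m} (\<lambda>_. ref_measure))"

definition unbiased_n :: "nat \<Rightarrow> ((nat \<Rightarrow> real \<times> real) \<Rightarrow> real) \<Rightarrow> bool" where
  "unbiased_n m T \<longleftrightarrow>
     (\<forall>\<theta>\<in>Theta. integrable (model m \<theta>) T \<and> (\<integral>x. T x \<partial>(model m \<theta>)) = \<theta> $ 3)"

text \<open>The variance takes values in \<open>[0, \<infinity>]\<close>, since an unbiased estimator need not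
  be square-integrable.\<close>

definition Var :: "nat \<Rightarrow> real ^ 3 \<Rightarrow> ((nat \<Rightarrow> real \<times> real) \<Rightarrow> real) \<Rightarrow> ennreal" where
  "Var m \<theta> T =
     (\<integral>\<^sup>+x. ennreal ((T x - (\<integral>y. T y \<partial>(model m \<theta>)))\<^sup>2) \<partial>(model m \<theta>))"

end

theory Submission imports Defs begin

text \<open>The bound is obtained as a limit of Chapman--Robbins bounds, so that no differentiation under
  the integral sign is needed for an arbitrary estimator. For \<open>\<theta>' = \<theta> + h *\<^sub>R v\<close> the second moment
  of the likelihood ratio under \<open>P \<theta>\<close> is an explicit rational function \<open>1 + h\<^sup>2 * Q h\<close> of \<open>h\<close>,
  and the \<open>m\<close>-fold product has second moment \<open>(1 + h\<^sup>2 * Q h) ^ m\<close>; dividing the resulting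
  inequality by \<open>h\<^sup>2\<close> and letting \<open>h\<close> tend to \<open>0\<close> gives \<open>1 \<le> V * m * Q 0\<close> if \<open>v $ 3 = 1\<close>. The
  optimal \<open>v\<close> is proportional to the third column of the inverse Fisher matrix. That matrix itself is
  elementary, because the second derivatives of the log-likelihood are constant on each of the regions
  \<open>s = t\<close>, \<open>s < t\<close> and \<open>s > t\<close>, whose probabilities are \<open>n / u\<close>, \<open>\<beta> / u\<close> and \<open>\<alpha> / u\<close>.\<close>

subsection \<open>The Chapman--Robbins inequality and product densities\<close>

text \<open>Monotone class induction on \<open>f\<close>. Only the supremum step needs care: a sum
  of two suprema is the supremum of the sums because both sequences of integrals increase.\<close>

lemma nn_integral_add_measure:
  assumes N: "sets N = sets M" and f: "f \<in> borel_measurable M"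
  shows "(\<integral>\<^sup>+x. f x \<partial>add_measure M N) = (\<integral>\<^sup>+x. f x \<partial>M) + (\<integral>\<^sup>+x. f x \<partial>N)"
  using f
proof induction
  case (cong f g)
  moreover have "space N = space M" using N by (rule sets_eq_imp_space_eq)
  ultimately have "(\<integral>\<^sup>+x. f x \<partial>K) = (\<integral>\<^sup>+x. g x \<partial>K)" if "K \<in> {M, N, add_measure M N}" for K
    using that by (intro nn_integral_cong) auto
  with cong show ?case by simp
next
  case (set A)
  then show ?case
    using N by (simp add: emeasure_add_measure)
next
  case (mult u c)
  then have "u \<in> borel_measurable N" "u \<in> borel_measurable (add_measure M N)"
    using N by (simp_all cong: measurable_cong_sets)
  with mult show ?case by (simp add: nn_integral_cmult distrib_left)
next
  case (add u v)
  then have "u \<in> borel_measurable N" "u \<in> borel_measurable (add_measure M N)"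
    "v \<in> borel_measurable N" "v \<in> borel_measurable (add_measure M N)"
    using N by (simp_all cong: measurable_cong_sets)
  with add show ?case by (simp add: nn_integral_add ac_simps)
next
  case (seq U)
  then have "U i \<in> borel_measurable N" "U i \<in> borel_measurable (add_measure M N)" for i
    using N by (simp_all cong: measurable_cong_sets)
  moreover have "incseq (\<lambda>i. \<integral>\<^sup>+x. U i x \<partial>M)" "incseq (\<lambda>i. \<integral>\<^sup>+x. U i x \<partial>N)"
    using seq by (auto intro!: incseq_nn_integral)
  ultimately show ?case
    using seq
    by (simp add: nn_integral_monotone_convergence_SUP ennreal_SUP_add image_comp)
qed

text \<open>Cauchy-Schwarz for the covariance of the likelihood ratio \<open>f\<close> and
  \<open>T\<close> under \<open>M\<close>: the change of the mean of \<open>T\<close> is that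
  covariance, and \<open>f\<close> has variance \<open>K - 1\<close> because it integrates to
  1.\<close>

lemma chapman_robbins:
  fixes f T :: "'a \<Rightarrow> real"
  assumes M: "prob_space M" and N: "prob_space (density M f)"
    and f[measurable]: "f \<in> borel_measurable M" and f_nonneg: "AE x in M. 0 \<le> f x"
    and T: "integrable M T" "integrable (density M f) T"
    and K: "(\<integral>\<^sup>+x. ennreal ((f x)\<^sup>2) \<partial>M) = ennreal K" "0 \<le> K"
    and V: "(\<integral>\<^sup>+x. ennreal ((T x - (\<integral>y. T y \<partial>M))\<^sup>2) \<partial>M) = ennreal V" "0 \<le> V"
  shows "((\<integral>x. T x \<partial>density M f) - (\<integral>x. T x \<partial>M))\<^sup>2 \<le> V * (K - 1)"
proof -
  interpret M: prob_space M by fact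
  define c where "c = (\<integral>x. T x \<partial>M)"
  have [measurable]: "T \<in> borel_measurable M" using T by auto
  have "(\<integral>\<^sup>+x. ennreal (f x) \<partial>M) = ennreal 1"
    using prob_space.emeasure_space_1[OF N] by (simp add: emeasure_density cong: nn_integral_cong)
  then have f_int: "has_bochner_integral M f 1"
    using f_nonneg by (intro has_bochner_integral_nn_integral) auto
  have f2_int: "has_bochner_integral M (\<lambda>x. (f x)\<^sup>2) K"
    using K by (intro has_bochner_integral_nn_integral) auto
  have fT_int: "integrable M (\<lambda>x. f x * T x)"
    using T(2) f_nonneg by (subst (asm) integrable_density) auto
  have "(\<integral>x. T x \<partial>density M f) = (\<integral>x. f x * T x \<partial>M)"
    using f_nonneg by (subst integral_density) auto
  \<comment> \<open>The product expands to \<open>f * T - T - c * f + c\<close>; its last three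
    terms have integral \<open>- c\<close> because \<open>f\<close> has integral 1.\<close>
  also have "\<dots> - c = (\<integral>x. (f x - 1) * (T x - c) \<partial>M)"
    using fT_int T(1) f_int by (simp add: algebra_simps c_def has_bochner_integral_iff M.prob_space)
  finally have diff: "(\<integral>x. T x \<partial>density M f) - c = (\<integral>x. (f x - 1) * (T x - c) \<partial>M)" .
  have "has_bochner_integral M (\<lambda>x. (f x)\<^sup>2 - 2 * f x + 1) (K - 2 * 1 + measure M (space M) * 1)"
    using f_int f2_int
    by (intro has_bochner_integral_add has_bochner_integral_diff has_bochner_integral_mult_right)
      (auto simp: has_bochner_integral_iff M.prob_space)
  then have "has_bochner_integral M (\<lambda>x. (f x - 1)\<^sup>2) (K - 1)"
    by (simp add: power2_diff M.prob_space algebra_simps)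
  then have f1: "(\<integral>\<^sup>+x. ennreal ((f x - 1)\<^sup>2) \<partial>M) = ennreal (K - 1)" and K1: "0 \<le> K - 1"
    by (auto simp: has_bochner_integral_iff nn_integral_eq_integral integral_nonneg_AE)
     (metis Bochner_Integration.integral_nonneg zero_le_power2 diff_ge_0_iff_ge)
  have "integrable M (\<lambda>x. (f x - 1) * (T x - c))"
    using fT_int T(1) f_int by (simp add: algebra_simps has_bochner_integral_iff)
  from integral_norm_bound_ennreal[OF this]
  have "ennreal (\<bar>\<integral>x. (f x - 1) * (T x - c) \<partial>M\<bar>) \<le> (\<integral>\<^sup>+x. ennreal \<bar>f x - 1\<bar> * ennreal \<bar>T x - c\<bar> \<partial>M)"
    by (simp add: abs_mult ennreal_mult)
  then have "(ennreal (\<bar>\<integral>x. (f x - 1) * (T x - c) \<partial>M\<bar>))\<^sup>2 \<le> (\<integral>\<^sup>+x. ennreal \<bar>f x - 1\<bar> * ennreal \<bar>T x - c\<bar> \<partial>M)\<^sup>2"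
    by (rule power_mono) simp
  also have "\<dots> \<le> (\<integral>\<^sup>+x. (ennreal \<bar>f x - 1\<bar>)\<^sup>2 \<partial>M) * (\<integral>\<^sup>+x. (ennreal \<bar>T x - c\<bar>)\<^sup>2 \<partial>M)"
    by (rule Cauchy_Schwarz_nn_integral) auto
  also have "\<dots> = ennreal ((K - 1) * V)"
    using f1 V K1 by (simp add: ennreal_power c_def ennreal_mult)
  finally have "(\<integral>x. (f x - 1) * (T x - c) \<partial>M)\<^sup>2 \<le> (K - 1) * V"
    using K1 V by (simp add: ennreal_power)
  then show ?thesis
    unfolding diff[unfolded c_def] c_def by (simp add: mult.commute)
qed

text \<open>A product measure is determined by its values on boxes. The indicator of a box
  factorizes, so Tonelli splits the integral there; sigma-finiteness of \<open>M\<close> serves this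
  splitting, that of the densities serves uniqueness.\<close>

lemma PiM_density:
  fixes f :: "'i \<Rightarrow> 'a \<Rightarrow> ennreal"
  assumes "finite I" "\<And>i. sigma_finite_measure (M i)"
    and "\<And>i. sigma_finite_measure (density (M i) (f i))"
    and f[measurable]: "\<And>i. f i \<in> borel_measurable (M i)"
  shows "PiM I (\<lambda>i. density (M i) (f i)) = density (PiM I M) (\<lambda>x. \<Prod>i\<in>I. f i (x i))"
proof -
  interpret M: product_sigma_finite M by (simp add: product_sigma_finite_def assms)
  interpret D: product_sigma_finite "\<lambda>i. density (M i) (f i)"
    by (simp add: product_sigma_finite_def assms)
  have "density (PiM I M) (\<lambda>x. \<Prod>i\<in>I. f i (x i)) = PiM I (\<lambda>i. density (M i) (f i))"
  proof (rule D.PiM_eqI)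
    show "finite I" by fact
    show "sets (density (PiM I M) (\<lambda>x. \<Prod>i\<in>I. f i (x i))) = sets (PiM I (\<lambda>i. density (M i) (f i)))"
      by (simp cong: sets_PiM_cong)
    fix A assume "\<And>i. i \<in> I \<Longrightarrow> A i \<in> sets (density (M i) (f i))"
    then have A[measurable]: "\<And>i. i \<in> I \<Longrightarrow> A i \<in> sets (M i)" by simp
    have "emeasure (density (PiM I M) (\<lambda>x. \<Prod>i\<in>I. f i (x i))) (Pi\<^sub>E I A) =
      (\<integral>\<^sup>+x. (\<Prod>i\<in>I. f i (x i)) * indicator (Pi\<^sub>E I A) x \<partial>PiM I M)"
      using A \<open>finite I\<close> by (subst emeasure_density) (auto intro!: sets_PiM_I_finite)
    also have "\<dots> = (\<integral>\<^sup>+x. (\<Prod>i\<in>I. f i (x i) * indicator (A i) (x i)) \<partial>PiM I M)"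
    proof (rule nn_integral_cong)
      fix x assume "x \<in> space (PiM I M)"
      then have "indicator (Pi\<^sub>E I A) x = (\<Prod>i\<in>I. indicator (A i) (x i) :: ennreal)"
        using \<open>finite I\<close>
        by (auto simp: indicator_def PiE_iff space_PiM intro!: prod_zero[symmetric])
      then show "(\<Prod>i\<in>I. f i (x i)) * indicator (Pi\<^sub>E I A) x =
          (\<Prod>i\<in>I. f i (x i) * indicator (A i) (x i))"
        by (simp add: prod.distrib)
    qed
    also have "\<dots> = (\<Prod>i\<in>I. \<integral>\<^sup>+x. f i x * indicator (A i) x \<partial>M i)"
      by (rule M.product_nn_integral_prod) (use \<open>finite I\<close> in auto)
    also have "\<dots> = (\<Prod>i\<in>I. emeasure (density (M i) (f i)) (A i))"
      using A by (intro prod.cong refl) (simp add: emeasure_density)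
    finally show "emeasure (density (PiM I M) (\<lambda>x. \<Prod>i\<in>I. f i (x i))) (Pi\<^sub>E I A) =
      (\<Prod>i\<in>I. emeasure (density (M i) (f i)) (A i))" .
  qed
  then show ?thesis ..
qed

lemma nn_integral_powr_from_0:
  fixes c l :: real
  assumes "0 < l" "0 \<le> c"
  shows "(\<integral>\<^sup>+x. indicator {0<..<c} x * ennreal (x powr (l - 1)) \<partial>lborel) = ennreal (c powr l / l)"
proof -
  \<comment> \<open>The endpoints are null, which allows passing to the closed interval of
    \<open>has_integral_powr_from_0\<close>.\<close>
  have "AE x in lborel. x \<noteq> 0 \<and> x \<noteq> c"
    using AE_lborel_singleton[of 0] AE_lborel_singleton[of c] by eventually_elim simp
  then have "AE x in lborel. indicator {0<..<c} x * ennreal (x powr (l - 1)) =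
      ennreal (indicator {0..c} x * x powr (l - 1))"
    by eventually_elim (auto simp: indicator_def)
  then have "(\<integral>\<^sup>+x. indicator {0<..<c} x * ennreal (x powr (l - 1)) \<partial>lborel) =
      (\<integral>\<^sup>+x. ennreal (indicator {0..c} x * x powr (l - 1)) \<partial>lborel)"
    by (rule nn_integral_cong_AE)
  also have "\<dots> = ennreal (c powr (l - 1 + 1) / (l - 1 + 1))"
    by (rule nn_integral_has_integral_lebesgue[OF _ has_integral_powr_from_0]) (use assms in auto)
  finally show ?thesis by simp
qed

subsection \<open>Integrals over the unit square with its diagonal\<close>

lemma sets_ref_measure [measurable_cong]: "sets ref_measure = sets (restrict_space borel unit_square)"
  by (simp add: ref_measure_def cong: sets_restrict_space_cong)

lemma space_ref_measure: "space ref_measure = unit_square"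
  by (simp add: ref_measure_def space_restrict_space)

lemma unit_square_sets [measurable]: "unit_square \<in> sets borel"
  unfolding unit_square_def by (intro borel_open open_Times) auto

lemma nn_integral_ref_measure:
  assumes f: "f \<in> borel_measurable borel"
  shows "(\<integral>\<^sup>+x. f x \<partial>ref_measure) =
    (\<integral>\<^sup>+x. indicator unit_square x * f x \<partial>lborel) + (\<integral>\<^sup>+s. indicator {0<..<1} s * f (s, s) \<partial>lborel)"
proof -
  have "f \<in> borel_measurable (restrict_space borel unit_square)"
    using f by (rule measurable_restrict_space1)
  moreover have "f \<in> borel_measurable (restrict_space lborel unit_square)"
    using f by (intro measurable_restrict_space1) simp
  ultimately show ?thesis
    using diag_measurable unfolding ref_measure_def
    by (subst nn_integral_add_measure)
      (simp_all add: sets_diag_measure diag_measure_def nn_integral_distr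
        nn_integral_restrict_space mult.commute cong: sets_restrict_space_cong)
qed

text \<open>This family contains the likelihood, the functions \<open>(L \<theta>' x)\<^sup>2 / L \<theta> x\<close> and the restrictions
  of the likelihood to the diagonal and to the two triangles.\<close>

definition piece :: "real \<Rightarrow> real \<Rightarrow> real \<Rightarrow> real \<Rightarrow> real \<Rightarrow> real \<Rightarrow> real \<times> real \<Rightarrow> real" where
  "piece k c0 c1 l1 c2 l2 = (\<lambda>(s, t).
     if s = t then c0 * s powr (k - 1)
     else if s < t then c1 * (t powr (k - l1 - 1) * s powr (l1 - 1))
     else c2 * (s powr (k - l2 - 1) * t powr (l2 - 1)))"

lemma borel_measurable_piece [measurable]: "piece k c0 c1 l1 c2 l2 \<in> borel_measurable borel"
  unfolding borel_prod[symmetric] piece_def by measurable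

text \<open>Integrating the smaller variable first yields
  \<open>t powr (k - l - 1) * t powr l / l\<close>: the parameter \<open>l\<close> drops out of the
  remaining power, and only \<open>k\<close> is left for the outer integral.\<close>

lemma nn_integral_triangle_inner:
  fixes k l t :: real
  assumes "0 < l"
  shows "(\<integral>\<^sup>+s. indicator {0<..<1} s * (indicator {0<..<1} t *
      (if s < t then ennreal (t powr (k - l - 1) * s powr (l - 1)) else 0)) \<partial>lborel) =
    ennreal (1 / l) * (indicator {0<..<1} t * ennreal (t powr (k - 1)))"
proof (cases "t \<in> {0<..<1}")
  case True
  have "(\<integral>\<^sup>+s. indicator {0<..<1} s * (indicator {0<..<1} t *
      (if s < t then ennreal (t powr (k - l - 1) * s powr (l - 1)) else 0)) \<partial>lborel) =
    (\<integral>\<^sup>+s. ennreal (t powr (k - l - 1)) * (indicator {0<..<t} s * ennreal (s powr (l - 1))) \<partial>lborel)"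
    using True by (intro nn_integral_cong) (auto simp: indicator_def ennreal_mult)
  also have "\<dots> = ennreal (t powr (k - l - 1)) * ennreal (t powr l / l)"
    using True assms by (simp add: nn_integral_cmult nn_integral_powr_from_0)
  also have "\<dots> = ennreal (1 / l) * ennreal (t powr (k - 1))"
    using True assms by (simp add: ennreal_mult[symmetric] powr_add[symmetric])
  finally show ?thesis using True by simp
qed simp

lemma nn_integral_triangle:
  fixes k l :: real
  assumes "0 < l" "0 < k"
  shows "(\<integral>\<^sup>+(s, t). indicator unit_square (s, t) *
      (if s < t then ennreal (t powr (k - l - 1) * s powr (l - 1)) else 0) \<partial>lborel) = ennreal (1 / (l * k))"
    and "(\<integral>\<^sup>+(s, t). indicator unit_square (s, t) *
      (if t < s then ennreal (s powr (k - l - 1) * t powr (l - 1)) else 0) \<partial>lborel) = ennreal (1 / (l * k))"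
proof -
  have ind: "indicator unit_square (s, t) = (indicator {0<..<1} s * indicator {0<..<1} t :: ennreal)" for s t
    by (simp add: unit_square_def indicator_times)
  have outer: "(\<integral>\<^sup>+t. ennreal (1 / l) * (indicator {0<..<1} t * ennreal (t powr (k - 1))) \<partial>lborel) =
      ennreal (1 / (l * k))"
    using assms nn_integral_powr_from_0[of k 1] by (simp add: nn_integral_cmult ennreal_mult[symmetric])
  let ?f = "\<lambda>(s, t). indicator {0<..<1} s * (indicator {0<..<1} t *
      (if s < t then ennreal (t powr (k - l - 1) * s powr (l - 1)) else 0))"
  \<comment> \<open>This order of the factors makes both triangles instances of the same inner
    integral, with \<open>s\<close> and \<open>t\<close> exchanged.\<close>
  let ?g = "\<lambda>(s, t). indicator {0<..<1} t * (indicator {0<..<1} s *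
      (if t < s then ennreal (s powr (k - l - 1) * t powr (l - 1)) else 0))"
  have f: "?f \<in> borel_measurable (lborel \<Otimes>\<^sub>M lborel)" by measurable
  have g: "?g \<in> borel_measurable (lborel \<Otimes>\<^sub>M lborel)" by measurable
  have "(\<integral>\<^sup>+x. ?f x \<partial>(lborel \<Otimes>\<^sub>M lborel)) = ennreal (1 / (l * k))"
    unfolding lborel_pair.nn_integral_snd[OF f, symmetric] prod.case
    by (simp only: nn_integral_triangle_inner[OF assms(1)] outer)
  then show "(\<integral>\<^sup>+(s, t). indicator unit_square (s, t) *
      (if s < t then ennreal (t powr (k - l - 1) * s powr (l - 1)) else 0) \<partial>lborel) = ennreal (1 / (l * k))"
    by (simp only: lborel_prod ind mult.assoc)
  have "(\<integral>\<^sup>+x. ?g x \<partial>(lborel \<Otimes>\<^sub>M lborel)) = ennreal (1 / (l * k))"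
    unfolding lborel.nn_integral_fst[OF g, symmetric] prod.case
    by (simp only: nn_integral_triangle_inner[OF assms(1)] outer)
  then show "(\<integral>\<^sup>+(s, t). indicator unit_square (s, t) *
      (if t < s then ennreal (s powr (k - l - 1) * t powr (l - 1)) else 0) \<partial>lborel) = ennreal (1 / (l * k))"
    by (simp only: lborel_prod ind mult.assoc mult.left_commute)
qed

text \<open>Each section of the diagonal is a single point, so Tonelli gives it Lebesgue measure
  zero.\<close>

lemma AE_lborel_off_diagonal: "AE x in lborel. fst x \<noteq> (snd x :: real)"
proof -
  define D where "D = {x :: real \<times> real. fst x = snd x}"
  have D: "D \<in> sets borel"
    unfolding D_def by (intro borel_closed closed_Collect_eq continuous_intros)
  then have D_pair [measurable]: "D \<in> sets (borel \<Otimes>\<^sub>M borel)" unfolding borel_prod .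
  have ind: "indicator D (s, t) = (indicator {s} t :: ennreal)" for s t
    by (auto simp: D_def indicator_def)
  have "emeasure lborel D = (\<integral>\<^sup>+x. indicator D x \<partial>(lborel \<Otimes>\<^sub>M lborel))"
    unfolding lborel_prod by (subst nn_integral_indicator) (simp_all add: D)
  also have "\<dots> = (\<integral>\<^sup>+s. \<integral>\<^sup>+t. indicator D (s, t) \<partial>lborel \<partial>lborel)"
    by (rule lborel.nn_integral_fst[symmetric]) measurable
  also have "\<dots> = 0" by (simp add: ind)
  finally have "emeasure lborel D = 0" .
  with D show ?thesis
    by (intro AE_I[of _ _ D]) (auto simp: D_def)
qed

text \<open>The Lebesgue part of \<open>ref_measure\<close> ignores the diagonal and sees only
  \<open>c1\<close> and \<open>c2\<close>, while the diagonal part sees only \<open>c0\<close>. The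
  inner integrals give the factors \<open>1 / l1\<close> and \<open>1 / l2\<close>, the outer one
  gives \<open>1 / k\<close>.\<close>

lemma nn_integral_piece:
  assumes c: "0 \<le> c0" "0 \<le> c1" "0 \<le> c2" and l: "0 < k" "0 < l1" "0 < l2"
  shows "(\<integral>\<^sup>+x. ennreal (piece k c0 c1 l1 c2 l2 x) \<partial>ref_measure) = ennreal ((c0 + c1 / l1 + c2 / l2) / k)"
proof -
  let ?f = "\<lambda>(s, t). indicator unit_square (s, t) *
      (if s < t then ennreal (t powr (k - l1 - 1) * s powr (l1 - 1)) else 0)"
  let ?g = "\<lambda>(s, t). indicator unit_square (s, t) *
      (if t < s then ennreal (s powr (k - l2 - 1) * t powr (l2 - 1)) else 0)"
  have [measurable]: "?f \<in> borel_measurable borel" "?g \<in> borel_measurable borel"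
    unfolding unit_square_def indicator_times borel_prod[symmetric] by measurable
  have "AE x in lborel. indicator unit_square x * ennreal (piece k c0 c1 l1 c2 l2 x) =
      ennreal c1 * ?f x + ennreal c2 * ?g x"
    using AE_lborel_off_diagonal
    by eventually_elim (use c in \<open>auto simp: piece_def ennreal_mult indicator_def\<close>)
  then have "(\<integral>\<^sup>+x. indicator unit_square x * ennreal (piece k c0 c1 l1 c2 l2 x) \<partial>lborel) =
      (\<integral>\<^sup>+x. ennreal c1 * ?f x + ennreal c2 * ?g x \<partial>lborel)"
    by (rule nn_integral_cong_AE)
  also have "\<dots> = ennreal (c1 / (l1 * k) + c2 / (l2 * k))"
    using c l by (subst nn_integral_add)
      (simp_all add: nn_integral_cmult nn_integral_triangle ennreal_mult[symmetric] del: ennreal_plus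
        flip: ennreal_plus)
  finally have off: "(\<integral>\<^sup>+x. indicator unit_square x * ennreal (piece k c0 c1 l1 c2 l2 x) \<partial>lborel) =
      ennreal (c1 / (l1 * k) + c2 / (l2 * k))" .
  have "(\<integral>\<^sup>+s. indicator {0<..<1} s * ennreal (piece k c0 c1 l1 c2 l2 (s, s)) \<partial>lborel) =
      (\<integral>\<^sup>+s. ennreal c0 * (indicator {0<..<1} s * ennreal (s powr (k - 1))) \<partial>lborel)"
    using c by (intro nn_integral_cong) (simp add: piece_def ennreal_mult ac_simps)
  also have "\<dots> = ennreal (c0 / k)"
    using c l nn_integral_powr_from_0[of k 1] by (simp add: nn_integral_cmult ennreal_mult[symmetric])
  finally show ?thesis
    using c l off
    by (subst nn_integral_ref_measure)
      (simp_all add: add_divide_distrib ac_simps del: ennreal_plus flip: ennreal_plus)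
qed

subsection \<open>Second moments of likelihood ratios\<close>

lemma borel_measurable_piece_ref [measurable]: "piece k c0 c1 l1 c2 l2 \<in> borel_measurable ref_measure"
proof -
  have "piece k c0 c1 l1 c2 l2 \<in> borel_measurable (restrict_space borel unit_square)"
    by (rule measurable_restrict_space1) measurable
  then show ?thesis by (simp add: measurable_cong_sets[OF sets_ref_measure refl])
qed

text \<open>The exponents agree because \<open>u - a = \<beta>\<close> and
  \<open>u - b = \<alpha>\<close>.\<close>

lemma L_eq_piece:
  "L \<theta> = piece (\<theta>$1 + \<theta>$2 - \<theta>$3) (\<theta>$3) (\<theta>$1 * (\<theta>$2 - \<theta>$3)) (\<theta>$1) (\<theta>$2 * (\<theta>$1 - \<theta>$3)) (\<theta>$2)"
  by (auto simp: fun_eq_iff L_def piece_def Let_def algebra_simps)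

lemma borel_measurable_L [measurable]: "L \<theta> \<in> borel_measurable ref_measure"
  unfolding L_eq_piece by measurable

lemma L_pos: "\<theta> \<in> Theta \<Longrightarrow> x \<in> unit_square \<Longrightarrow> 0 < L \<theta> x"
  by (auto simp: L_def Let_def Theta_def unit_square_def)

lemma sets_P [simp, measurable_cong]: "sets (P \<theta>) = sets ref_measure"
  and space_P [simp]: "space (P \<theta>) = unit_square"
  by (simp_all add: P_def space_ref_measure)

lemma nn_integral_P:
  assumes "f \<in> borel_measurable ref_measure" "\<theta> \<in> Theta" "\<And>x. x \<in> unit_square \<Longrightarrow> 0 \<le> f x"
  shows "(\<integral>\<^sup>+x. ennreal (f x) \<partial>P \<theta>) = (\<integral>\<^sup>+x. ennreal (L \<theta> x * f x) \<partial>ref_measure)"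
  using assms unfolding P_def
  by (subst nn_integral_density)
    (auto intro!: nn_integral_cong simp: ennreal_mult L_pos less_imp_le space_ref_measure)

lemma prob_space_P:
  assumes "\<theta> \<in> Theta"
  shows "prob_space (P \<theta>)"
proof (rule prob_spaceI)
  have pos: "0 < \<theta>$3" "0 < \<theta>$1" "0 < \<theta>$2" "0 < \<theta>$1 - \<theta>$3" "0 < \<theta>$2 - \<theta>$3"
    "0 < \<theta>$1 + \<theta>$2 - \<theta>$3"
    using assms by (auto simp: Theta_def)
  \<comment> \<open>The diagonal and the two triangles contribute n, \<beta> and \<alpha>, each over
    u; these numerators add up to u.\<close>
  then have total: "\<theta>$3 + \<theta>$1 * (\<theta>$2 - \<theta>$3) / \<theta>$1 + \<theta>$2 * (\<theta>$1 - \<theta>$3) / \<theta>$2 = \<theta>$1 + \<theta>$2 - \<theta>$3"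
    by simp
  have "emeasure (P \<theta>) (space (P \<theta>)) = (\<integral>\<^sup>+x. ennreal (L \<theta> x) \<partial>ref_measure)"
    using nn_integral_P[OF _ assms, of "\<lambda>_. 1"] by (simp add: emeasure_density)
  also have "\<dots> = 1"
    unfolding L_eq_piece using pos total by (subst nn_integral_piece) simp_all
  finally show "emeasure (P \<theta>) (space (P \<theta>)) = 1" .
qed

text \<open>On each region a \<open>piece\<close> is a monomial, so squaring and dividing acts
  linearly on exponents. The shift by one survives because
  \<open>2 * (p - 1) - (q - 1) = 2 * p - q - 1\<close>.\<close>

lemma piece_square_ratio:
  assumes "x \<in> unit_square"
  shows "(piece k' c0' c1' l1' c2' l2' x)\<^sup>2 / piece k c0 c1 l1 c2 l2 x =
    piece (2 * k' - k) (c0'\<^sup>2 / c0) (c1'\<^sup>2 / c1) (2 * l1' - l1) (c2'\<^sup>2 / c2) (2 * l2' - l2) x"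
proof -
  have powr: "(s powr p)\<^sup>2 / s powr q = s powr r" if "0 < s" "2 * p - q = r" for s p q r :: real
    using that by (auto simp: powr_diff power2_eq_square powr_add[symmetric])
  have mult1: "(c' * x')\<^sup>2 / (c * x) = c'\<^sup>2 / c * (x'\<^sup>2 / x)" for c' x' c x :: real
    by (simp add: power_mult_distrib)
  obtain s t where x: "x = (s, t)" by force
  with assms have st: "0 < s" "0 < t" by (auto simp: unit_square_def)
  have powr1: "(s powr (k' - 1))\<^sup>2 / s powr (k - 1) = s powr (2 * k' - k - 1)"
    using st by (intro powr) auto
  have powr2: "(x powr (k' - l' - 1) * y powr (l' - 1))\<^sup>2 / (x powr (k - l - 1) * y powr (l - 1)) =
      x powr (2 * k' - k - (2 * l' - l) - 1) * y powr (2 * l' - l - 1)"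
    if "0 < x" "0 < y" for x y l l' :: real
    unfolding mult1 using that by (intro arg_cong2[where f = "(*)"] powr) auto
  show ?thesis
    unfolding x piece_def prod.case
    using st by (auto simp only: mult1 powr1 powr2[unfolded mult1] split: if_split)
qed

lemma P_eq_density:
  assumes "\<theta> \<in> Theta" "\<theta>' \<in> Theta"
  shows "P \<theta>' = density (P \<theta>) (\<lambda>x. ennreal (L \<theta>' x / L \<theta> x))"
proof -
  have "L \<theta> x * (L \<theta>' x / L \<theta> x) = L \<theta>' x" if "x \<in> unit_square" for x
    using L_pos[OF assms(1) that] by simp
  then show ?thesis
    unfolding P_def using assms
    by (subst density_density_eq)
      (auto intro!: density_cong AE_I2 simp: space_ref_measure ennreal_mult[symmetric] L_pos less_imp_le)
qed

text \<open>This is \<open>nn_integral_piece\<close> evaluated at the coefficients of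
  \<open>piece_square_ratio\<close>. For \<open>\<theta>'\<close> close to \<open>\<theta>\<close>
  it equals one plus the chi-square divergence of \<open>P \<theta>'\<close> from
  \<open>P \<theta>\<close>.\<close>

definition ratio_moment :: "real ^ 3 \<Rightarrow> real ^ 3 \<Rightarrow> real" where
  "ratio_moment \<theta> \<theta>' =
    ((\<theta>'$3)\<^sup>2 / \<theta>$3
      + (\<theta>'$1 * (\<theta>'$2 - \<theta>'$3))\<^sup>2 / (\<theta>$1 * (\<theta>$2 - \<theta>$3)) / (2 * \<theta>'$1 - \<theta>$1)
      + (\<theta>'$2 * (\<theta>'$1 - \<theta>'$3))\<^sup>2 / (\<theta>$2 * (\<theta>$1 - \<theta>$3)) / (2 * \<theta>'$2 - \<theta>$2))
    / (2 * (\<theta>'$1 + \<theta>'$2 - \<theta>'$3) - (\<theta>$1 + \<theta>$2 - \<theta>$3))"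

text \<open>The three conditions \<open>pos\<close> are \<open>0 < l1\<close>, \<open>0 < l2\<close>
  and \<open>0 < k\<close> for the squared ratio, that is, integrability of the powers at 0.\<close>

lemma nn_integral_ratio_square:
  assumes "\<theta> \<in> Theta" "\<theta>' \<in> Theta"
    and pos: "0 < 2 * \<theta>'$1 - \<theta>$1" "0 < 2 * \<theta>'$2 - \<theta>$2"
      "0 < 2 * (\<theta>'$1 + \<theta>'$2 - \<theta>'$3) - (\<theta>$1 + \<theta>$2 - \<theta>$3)"
  shows "(\<integral>\<^sup>+x. ennreal ((L \<theta>' x / L \<theta> x)\<^sup>2) \<partial>P \<theta>) = ennreal (ratio_moment \<theta> \<theta>')"
    and "0 \<le> ratio_moment \<theta> \<theta>'"
proof -
  have "(\<integral>\<^sup>+x. ennreal ((L \<theta>' x / L \<theta> x)\<^sup>2) \<partial>P \<theta>) =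
      (\<integral>\<^sup>+x. ennreal (L \<theta> x * (L \<theta>' x / L \<theta> x)\<^sup>2) \<partial>ref_measure)"
    by (rule nn_integral_P) (use assms in auto)
  also have "\<dots> = (\<integral>\<^sup>+x. ennreal ((L \<theta>' x)\<^sup>2 / L \<theta> x) \<partial>ref_measure)"
    using L_pos[OF assms(1)]
    by (intro nn_integral_cong) (simp add: power2_eq_square space_ref_measure)
  also have "\<dots> = ennreal (ratio_moment \<theta> \<theta>')"
    unfolding ratio_moment_def L_eq_piece
    using assms nn_integral_cong[OF arg_cong[OF piece_square_ratio, of _ ennreal], of ref_measure]
    by (simp add: space_ref_measure nn_integral_piece Theta_def)
  finally show "(\<integral>\<^sup>+x. ennreal ((L \<theta>' x / L \<theta> x)\<^sup>2) \<partial>P \<theta>) = ennreal (ratio_moment \<theta> \<theta>')" .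
  show "0 \<le> ratio_moment \<theta> \<theta>'"
    using assms by (auto simp: ratio_moment_def Theta_def intro!: divide_nonneg_nonneg add_nonneg_nonneg)
qed

section \<open>The product model of m independent observations\<close>

lemma model_eq_density:
  assumes "\<theta> \<in> Theta" "\<theta>' \<in> Theta"
  shows "model m \<theta>' = density (model m \<theta>) (\<lambda>x. ennreal (\<Prod>k\<in>{1..m}. L \<theta>' (x k) / L \<theta> (x k)))"
proof -
  have sf: "sigma_finite_measure (P \<theta>)" if "\<theta> \<in> Theta" for \<theta>
    using prob_space_P[OF that] by (simp add: prob_space_imp_sigma_finite)
  have "model m \<theta>' = density (model m \<theta>) (\<lambda>x. \<Prod>k\<in>{1..m}. ennreal (L \<theta>' (x k) / L \<theta> (x k)))"
    unfolding model_def P_eq_density[OF assms]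
    by (rule PiM_density) (auto simp: sf assms P_eq_density[OF assms, symmetric])
  also have "\<dots> = density (model m \<theta>) (\<lambda>x. ennreal (\<Prod>k\<in>{1..m}. L \<theta>' (x k) / L \<theta> (x k)))"
    by (rule density_cong)
      (auto simp: model_def space_PiM PiE_iff L_pos assms less_imp_le intro!: prod_ennreal)
  finally show ?thesis .
qed

lemma nn_integral_model_ratio_square:
  assumes "\<theta> \<in> Theta" "\<theta>' \<in> Theta"
    and pos: "0 < 2 * \<theta>'$1 - \<theta>$1" "0 < 2 * \<theta>'$2 - \<theta>$2"
      "0 < 2 * (\<theta>'$1 + \<theta>'$2 - \<theta>'$3) - (\<theta>$1 + \<theta>$2 - \<theta>$3)"
  shows "(\<integral>\<^sup>+x. ennreal ((\<Prod>k\<in>{1..m}. L \<theta>' (x k) / L \<theta> (x k))\<^sup>2) \<partial>model m \<theta>) =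
    ennreal (ratio_moment \<theta> \<theta>' ^ m)"
proof -
  interpret product_sigma_finite "\<lambda>_::nat. P \<theta>"
    using prob_space_P[OF assms(1)] by (simp add: product_sigma_finite_def prob_space_imp_sigma_finite)
  have "(\<integral>\<^sup>+x. ennreal ((\<Prod>k\<in>{1..m}. L \<theta>' (x k) / L \<theta> (x k))\<^sup>2) \<partial>model m \<theta>) =
      (\<integral>\<^sup>+x. (\<Prod>k\<in>{1..m}. ennreal ((L \<theta>' (x k) / L \<theta> (x k))\<^sup>2)) \<partial>model m \<theta>)"
    by (simp add: prod_power_distrib prod_ennreal)
  also have "\<dots> = ennreal (ratio_moment \<theta> \<theta>' ^ m)"
    unfolding model_def using nn_integral_ratio_square[OF assms]
    by (subst product_nn_integral_prod) (auto simp: ennreal_power)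
  finally show ?thesis .
qed

lemma prob_space_model: "\<theta> \<in> Theta \<Longrightarrow> prob_space (model m \<theta>)"
  unfolding model_def by (intro prob_space_PiM prob_space_P)

text \<open>Unbiasedness enters at both \<open>\<theta>\<close> and \<open>\<theta>'\<close>: it
  identifies the change of the mean with the change of the third coordinate.\<close>

lemma chapman_robbins_model:
  assumes "\<theta> \<in> Theta" "\<theta>' \<in> Theta"
    and pos: "0 < 2 * \<theta>'$1 - \<theta>$1" "0 < 2 * \<theta>'$2 - \<theta>$2"
      "0 < 2 * (\<theta>'$1 + \<theta>'$2 - \<theta>'$3) - (\<theta>$1 + \<theta>$2 - \<theta>$3)"
    and T: "unbiased_n m T" and V: "Var m \<theta> T = ennreal V" "0 \<le> V"
  shows "(\<theta>'$3 - \<theta>$3)\<^sup>2 \<le> V * (ratio_moment \<theta> \<theta>' ^ m - 1)"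
proof -
  have T_int: "integrable (model m \<theta>) T" "(\<integral>x. T x \<partial>model m \<theta>) = \<theta>$3" if "\<theta> \<in> Theta" for \<theta>
    using T that by (auto simp: unbiased_n_def)
  define r where "r = (\<lambda>x. \<Prod>k\<in>{1..m}. L \<theta>' (x k) / L \<theta> (x k))"
  have density: "density (model m \<theta>) (\<lambda>x. ennreal (r x)) = model m \<theta>'"
    using model_eq_density[OF assms(1,2)] by (simp add: r_def)
  have "((\<integral>x. T x \<partial>density (model m \<theta>) r) - (\<integral>x. T x \<partial>model m \<theta>))\<^sup>2
      \<le> V * (ratio_moment \<theta> \<theta>' ^ m - 1)"
  proof (rule chapman_robbins)
    show "r \<in> borel_measurable (model m \<theta>)" unfolding model_def r_def by measurable
    show "AE x in model m \<theta>. 0 \<le> r x"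
      by (rule AE_I2)
        (auto simp: r_def model_def space_PiM PiE_iff L_pos assms less_imp_le intro!: prod_nonneg)
    show "0 \<le> ratio_moment \<theta> \<theta>' ^ m"
      using nn_integral_ratio_square[OF assms(1-5)] by simp
    show "(\<integral>\<^sup>+x. ennreal ((r x)\<^sup>2) \<partial>model m \<theta>) = ennreal (ratio_moment \<theta> \<theta>' ^ m)"
      unfolding r_def by (rule nn_integral_model_ratio_square[OF assms(1-5)])
  qed (use V in \<open>simp_all add: density T_int assms(1,2) prob_space_model Var_def\<close>)
  then show ?thesis
    by (simp add: density T_int assms(1,2))
qed

subsection \<open>The Fisher information matrix\<close>

text \<open>On \<open>Theta\<close> the log-likelihood of one observation \<open>x\<close> is
  \<open>ln (form1 x \<bullet> \<theta>) + weight x * ln (form2 x \<bullet> \<theta>)\<close> plus an affine function of \<open>\<theta>\<close>.\<close>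

definition form1 :: "real \<times> real \<Rightarrow> real ^ 3" where
  "form1 = (\<lambda>(s, t). if s = t then axis 3 1 else if s < t then axis 1 1 else axis 2 1)"

text \<open>On the diagonal \<open>weight\<close> vanishes; the value chosen there still keeps
  \<open>form2 x \<bullet> \<theta>\<close> positive, so \<open>form_pos\<close> holds for every
  \<open>x\<close>.\<close>

definition form2 :: "real \<times> real \<Rightarrow> real ^ 3" where
  "form2 = (\<lambda>(s, t). if t < s then axis 1 1 - axis 3 1 else axis 2 1 - axis 3 1)"

definition weight :: "real \<times> real \<Rightarrow> real" where
  "weight = (\<lambda>(s, t). if s = t then 0 else 1)"

text \<open>In all three regions the part of the log-likelihood coming from the powers is
  \<open>a * ln s + b * ln t - n * ln (max s t)\<close>, up to a term free of \<theta>.\<close>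

definition slope :: "real \<times> real \<Rightarrow> real ^ 3" where
  "slope = (\<lambda>(s, t). ln s *\<^sub>R axis 1 1 + ln t *\<^sub>R axis 2 1 - ln (max s t) *\<^sub>R axis 3 1)"

definition score :: "3 \<Rightarrow> real ^ 3 \<Rightarrow> real \<times> real \<Rightarrow> real" where
  "score i \<theta> x = form1 x $ i / (form1 x \<bullet> \<theta>) + weight x * (form2 x $ i / (form2 x \<bullet> \<theta>)) + slope x $ i"

definition hess :: "3 \<Rightarrow> 3 \<Rightarrow> real ^ 3 \<Rightarrow> real \<times> real \<Rightarrow> real" where
  "hess i j \<theta> x = - (form1 x $ i * form1 x $ j / (form1 x \<bullet> \<theta>)\<^sup>2)
     - weight x * (form2 x $ i * form2 x $ j / (form2 x \<bullet> \<theta>)\<^sup>2)"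

lemma form_pos:
  assumes "\<theta> \<in> Theta"
  shows "0 < form1 x \<bullet> \<theta>" "0 < form2 x \<bullet> \<theta>"
  using assms by (auto simp: form1_def form2_def Theta_def inner_axis' inner_diff_left split: prod.split)

text \<open>The subtracted term collects the \<open>- 1\<close> of the exponents. It does not depend
  on \<theta> and disappears under differentiation.\<close>

lemma ln_L:
  assumes "\<theta> \<in> Theta" "x \<in> unit_square"
  shows "ln (L \<theta> x) = ln (form1 x \<bullet> \<theta>) + weight x * ln (form2 x \<bullet> \<theta>) + slope x \<bullet> \<theta>
     - (if fst x = snd x then ln (fst x) else ln (fst x) + ln (snd x))"
  using assms
  by (cases x) (auto simp: L_def Let_def form1_def form2_def weight_def slope_def Theta_def unit_square_def
      inner_axis' inner_diff_left inner_add_left ln_mult ln_powr max_def,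
      simp_all add: algebra_simps)

lemma open_Theta: "open Theta"
  unfolding Theta_def by (intro open_Collect_conj open_Collect_less continuous_intros)

lemma coord_update: "(\<chi> k. if k = i then z else \<theta> $ k) = \<theta> + (z - \<theta> $ i) *\<^sub>R axis i (1 :: real)"
  by (simp add: vec_eq_iff axis_def)

text \<open>\<open>deriv\<close> depends only on values near the point, and \<open>Theta\<close> is
  open; hence formulas valid only on \<open>Theta\<close> may be differentiated there.\<close>

lemma partial_deriv_cong_Theta:
  assumes "\<theta> \<in> Theta" "\<And>\<theta>'. \<theta>' \<in> Theta \<Longrightarrow> f \<theta>' = g \<theta>'"
  shows "partial_deriv i f \<theta> = partial_deriv i g \<theta>"
proof -
  have "((\<lambda>z. \<theta> + (z - \<theta> $ i) *\<^sub>R axis i 1) \<longlongrightarrow> \<theta> + (\<theta> $ i - \<theta> $ i) *\<^sub>R axis i 1) (nhds (\<theta> $ i))"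
    by (intro tendsto_intros filterlim_ident)
  then have "\<forall>\<^sub>F z in nhds (\<theta> $ i). \<theta> + (z - \<theta> $ i) *\<^sub>R axis i 1 \<in> Theta"
    using open_Theta assms(1) by (auto dest: topological_tendstoD)
  then show ?thesis
    unfolding partial_deriv_def coord_update
    by (intro deriv_cong_ev refl) (auto elim!: eventually_mono simp: assms)
qed

lemma DERIV_inner_line:
  "((\<lambda>z. c \<bullet> (\<theta> + (z - \<theta> $ i) *\<^sub>R axis i 1)) has_real_derivative c $ i) (at z)"
  by (auto simp: inner_add_right inner_axis intro!: derivative_eq_intros)

lemma partial_deriv_ln_L:
  assumes "finite A" "\<theta> \<in> Theta" "\<And>k. k \<in> A \<Longrightarrow> x k \<in> unit_square"
  shows "partial_deriv i (\<lambda>\<theta>'. ln (\<Prod>k\<in>A. L \<theta>' (x k))) \<theta> = (\<Sum>k\<in>A. score i \<theta> (x k))"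
proof -
  let ?l = "\<lambda>\<theta> x. ln (form1 x \<bullet> \<theta>) + weight x * ln (form2 x \<bullet> \<theta>) + slope x \<bullet> \<theta>
     - (if fst x = snd x then ln (fst x) else ln (fst x) + ln (snd x))"
  have "L \<theta>' (x k) \<noteq> 0" if "\<theta>' \<in> Theta" "k \<in> A" for \<theta>' k
    using L_pos[of \<theta>' "x k"] that assms(3) by simp
  then have "partial_deriv i (\<lambda>\<theta>'. ln (\<Prod>k\<in>A. L \<theta>' (x k))) \<theta> =
      partial_deriv i (\<lambda>\<theta>'. \<Sum>k\<in>A. ?l \<theta>' (x k)) \<theta>"
    using assms by (intro partial_deriv_cong_Theta) (simp_all add: ln_prod ln_L)
  also have "\<dots> = (\<Sum>k\<in>A. score i \<theta> (x k))"
    unfolding partial_deriv_def coord_update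
    by (intro DERIV_imp_deriv)
      (auto intro!: derivative_eq_intros DERIV_inner_line sum.cong simp: form_pos assms score_def divide_simps)
  finally show ?thesis .
qed

lemma partial_deriv_score:
  assumes "\<theta> \<in> Theta"
  shows "partial_deriv i (\<lambda>\<theta>'. \<Sum>k\<in>A. score j \<theta>' (x k)) \<theta> = (\<Sum>k\<in>A. hess i j \<theta> (x k))"
proof -
  have nz: "form1 y \<bullet> \<theta> \<noteq> 0" "form2 y \<bullet> \<theta> \<noteq> 0" for y
    using form_pos[OF assms, of y] by auto
  show ?thesis
    unfolding partial_deriv_def coord_update score_def
    by (intro DERIV_imp_deriv)
      (auto intro!: derivative_eq_intros DERIV_inner_line sum.cong simp: nz hess_def power2_eq_square
        ac_simps)
qed

lemma partial_deriv_twice_ln_L: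
  assumes "finite A" "\<theta> \<in> Theta" "\<And>k. k \<in> A \<Longrightarrow> x k \<in> unit_square"
  shows "partial_deriv i (partial_deriv j (\<lambda>\<theta>'. ln (\<Prod>k\<in>A. L \<theta>' (x k)))) \<theta> =
    (\<Sum>k\<in>A. hess i j \<theta> (x k))"
proof -
  \<comment> \<open>The first-order formula holds throughout \<open>Theta\<close>, so it may replace
    the inner derivative under the outer one.\<close>
  have "partial_deriv i (partial_deriv j (\<lambda>\<theta>'. ln (\<Prod>k\<in>A. L \<theta>' (x k)))) \<theta> =
      partial_deriv i (\<lambda>\<theta>'. \<Sum>k\<in>A. score j \<theta>' (x k)) \<theta>"
    using assms by (intro partial_deriv_cong_Theta partial_deriv_ln_L) auto
  then show ?thesis
    by (simp add: partial_deriv_score assms)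
qed

section \<open>Region probabilities and the expected Hessian\<close>

lemma has_bochner_integral_P_regions:
  assumes "\<theta> \<in> Theta"
  shows "has_bochner_integral (P \<theta>) (\<lambda>x. of_bool (fst x = snd x)) (\<theta>$3 / (\<theta>$1 + \<theta>$2 - \<theta>$3))"
    and "has_bochner_integral (P \<theta>) (\<lambda>x. of_bool (fst x < snd x)) ((\<theta>$2 - \<theta>$3) / (\<theta>$1 + \<theta>$2 - \<theta>$3))"
    and "has_bochner_integral (P \<theta>) (\<lambda>x. of_bool (snd x < fst x)) ((\<theta>$1 - \<theta>$3) / (\<theta>$1 + \<theta>$2 - \<theta>$3))"
proof -
  have pos: "0 < \<theta>$3" "0 < \<theta>$1" "0 < \<theta>$2" "0 < \<theta>$1 - \<theta>$3" "0 < \<theta>$2 - \<theta>$3"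
    "0 < \<theta>$1 + \<theta>$2 - \<theta>$3"
    using assms by (auto simp: Theta_def)
  have "(\<lambda>x :: real \<times> real. of_bool (fst x = snd x) :: real) \<in> borel_measurable borel"
      "(\<lambda>x :: real \<times> real. of_bool (fst x < snd x) :: real) \<in> borel_measurable borel"
      "(\<lambda>x :: real \<times> real. of_bool (snd x < fst x) :: real) \<in> borel_measurable borel"
    unfolding borel_prod[symmetric] by measurable
  then have [measurable]:
      "(\<lambda>x. of_bool (fst x = snd x) :: real) \<in> borel_measurable ref_measure"
      "(\<lambda>x. of_bool (fst x < snd x) :: real) \<in> borel_measurable ref_measure"
      "(\<lambda>x. of_bool (snd x < fst x) :: real) \<in> borel_measurable ref_measure"
    by (simp_all add: measurable_cong_sets[OF sets_ref_measure refl] measurable_restrict_space1)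
  let ?u = "\<theta>$1 + \<theta>$2 - \<theta>$3"
  \<comment> \<open>Restricting the likelihood to one region sets the other two coefficients of its
    \<open>piece\<close> to zero, so \<open>nn_integral_piece\<close> yields the
    probabilities.\<close>
  have piece: "L \<theta> x * of_bool (fst x = snd x) = piece ?u (\<theta>$3) 0 (\<theta>$1) 0 (\<theta>$2) x"
    "L \<theta> x * of_bool (fst x < snd x) = piece ?u 0 (\<theta>$1 * (\<theta>$2 - \<theta>$3)) (\<theta>$1) 0 (\<theta>$2) x"
    "L \<theta> x * of_bool (snd x < fst x) = piece ?u 0 0 (\<theta>$1) (\<theta>$2 * (\<theta>$1 - \<theta>$3)) (\<theta>$2) x" for x
    by (auto simp: L_eq_piece piece_def split: prod.split)
  have meas: "f \<in> borel_measurable (P \<theta>)" if "f \<in> borel_measurable ref_measure" for f :: "_ \<Rightarrow> real"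
    using that by measurable
  show "has_bochner_integral (P \<theta>) (\<lambda>x. of_bool (fst x = snd x)) (\<theta>$3 / ?u)"
    "has_bochner_integral (P \<theta>) (\<lambda>x. of_bool (fst x < snd x)) ((\<theta>$2 - \<theta>$3) / ?u)"
    "has_bochner_integral (P \<theta>) (\<lambda>x. of_bool (snd x < fst x)) ((\<theta>$1 - \<theta>$3) / ?u)"
    using pos
    by (auto intro!: has_bochner_integral_nn_integral meas
        simp: nn_integral_P assms piece nn_integral_piece)
qed

text \<open>On each region minus the Hessian is a combination of rank-one matrices, built from
  \<open>e 3\<close> on the diagonal, from \<open>e 1\<close> and \<open>e 2 - e 3\<close> for
  \<open>s < t\<close>, and from \<open>e 2\<close> and \<open>e 1 - e 3\<close> for
  \<open>s > t\<close>; the region probabilities are the weights.\<close>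

lemma expectation_hess:
  assumes "\<theta> \<in> Theta"
  defines "a \<equiv> \<theta> $ 1" and "b \<equiv> \<theta> $ 2" and "n \<equiv> \<theta> $ 3"
  defines "e \<equiv> (\<lambda>i. axis i 1 :: real ^ 3)"
  shows "has_bochner_integral (P \<theta>) (hess i j \<theta>)
    (- (e 3 $ i * e 3 $ j / n\<^sup>2 * (n / (a + b - n))
      + (e 1 $ i * e 1 $ j / a\<^sup>2 + (e 2 - e 3) $ i * (e 2 - e 3) $ j / (b - n)\<^sup>2) * ((b - n) / (a + b - n))
      + (e 2 $ i * e 2 $ j / b\<^sup>2 + (e 1 - e 3) $ i * (e 1 - e 3) $ j / (a - n)\<^sup>2) * ((a - n) / (a + b - n))))"
proof -
  have "hess i j \<theta> = (\<lambda>x. - (e 3 $ i * e 3 $ j / n\<^sup>2 * of_bool (fst x = snd x)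
      + (e 1 $ i * e 1 $ j / a\<^sup>2 + (e 2 - e 3) $ i * (e 2 - e 3) $ j / (b - n)\<^sup>2) * of_bool (fst x < snd x)
      + (e 2 $ i * e 2 $ j / b\<^sup>2 + (e 1 - e 3) $ i * (e 1 - e 3) $ j / (a - n)\<^sup>2) * of_bool (snd x < fst x)))"
    by (rule ext) (simp add: hess_def form1_def form2_def weight_def split_beta' inner_axis'
        inner_diff_left a_def b_def n_def e_def)
  then show ?thesis
    unfolding a_def b_def n_def
    by (simp only:) (intro has_bochner_integral_minus has_bochner_integral_add
        has_bochner_integral_mult_right has_bochner_integral_P_regions[OF assms(1)])
qed

text \<open>Every coordinate of the product measure has law \<open>P \<theta>\<close>, so the m
  terms of the summed Hessian have the same expectation.\<close>

lemma fisher_entry: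
  assumes "\<theta> \<in> Theta"
  shows "fisher m \<theta> $ i $ j = - (real m * (\<integral>x. hess i j \<theta> x \<partial>P \<theta>))"
proof -
  have P: "prob_space (P \<theta>)" using assms by (rule prob_space_P)
  have int: "integrable (P \<theta>) (hess i j \<theta>)"
    using expectation_hess[OF assms] by (simp add: has_bochner_integral_iff)
  then have "hess i j \<theta> \<in> borel_measurable (P \<theta>)" by auto
  have comp: "integrable (model m \<theta>) (\<lambda>x. hess i j \<theta> (x k))"
    "(\<integral>x. hess i j \<theta> (x k) \<partial>model m \<theta>) = (\<integral>x. hess i j \<theta> x \<partial>P \<theta>)" if k: "k \<in> {1..m}" for k
  proof -
    have d: "distr (model m \<theta>) (P \<theta>) (\<lambda>x. x k) = P \<theta>"
      unfolding model_def using k by (intro distr_PiM_component P)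
    have [measurable]: "(\<lambda>x. x k) \<in> measurable (model m \<theta>) (P \<theta>)"
      unfolding model_def using k by measurable
    show "integrable (model m \<theta>) (\<lambda>x. hess i j \<theta> (x k))"
      using int by (subst (asm) d[symmetric], subst (asm) integrable_distr_eq) auto
    show "(\<integral>x. hess i j \<theta> (x k) \<partial>model m \<theta>) = (\<integral>x. hess i j \<theta> x \<partial>P \<theta>)"
    proof -
      have "(\<integral>x. hess i j \<theta> x \<partial>P \<theta>) = (\<integral>x. hess i j \<theta> x \<partial>distr (model m \<theta>) (P \<theta>) (\<lambda>x. x k))"
        by (simp add: d)
      also have "\<dots> = (\<integral>x. hess i j \<theta> (x k) \<partial>model m \<theta>)"
        using int by (intro integral_distr) auto
      finally show ?thesis ..
    qed
  qed
  have "(\<integral>x. partial_deriv i (partial_deriv j (\<lambda>\<theta>'. ln (\<Prod>k\<in>{1..m}. L \<theta>' (x k)))) \<theta> \<partial>model m \<theta>) =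
      (\<integral>x. (\<Sum>k\<in>{1..m}. hess i j \<theta> (x k)) \<partial>model m \<theta>)"
    by (intro Bochner_Integration.integral_cong refl partial_deriv_twice_ln_L assms)
      (auto simp: model_def space_PiM PiE_iff)
  also have "\<dots> = real m * (\<integral>x. hess i j \<theta> x \<partial>P \<theta>)"
    using comp by simp
  finally show ?thesis by (simp add: fisher_def)
qed

subsection \<open>The limit of the Chapman--Robbins bounds\<close>

text \<open>The difference \<open>ratio_moment \<theta> \<theta>' - 1\<close> along the line through
  \<theta> in direction (p, q, 1), with the factor \<open>h\<^sup>2\<close> already divided out so
  that \<open>h = 0\<close> makes sense. The value there is the Fisher information of one
  observation in that direction.\<close>

definition line_excess :: "real ^ 3 \<Rightarrow> real \<Rightarrow> real \<Rightarrow> real \<Rightarrow> real" where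
  "line_excess \<theta> p q h =
    (1 / \<theta>$3 + (q - 1)\<^sup>2 / (\<theta>$2 - \<theta>$3) + (p - 1)\<^sup>2 / (\<theta>$1 - \<theta>$3)
      + p\<^sup>2 * (\<theta>$2 - \<theta>$3 + h * (q - 1))\<^sup>2 / ((\<theta>$2 - \<theta>$3) * \<theta>$1 * (\<theta>$1 + 2 * h * p))
      + q\<^sup>2 * (\<theta>$1 - \<theta>$3 + h * (p - 1))\<^sup>2 / ((\<theta>$1 - \<theta>$3) * \<theta>$2 * (\<theta>$2 + 2 * h * q)))
    / (\<theta>$1 + \<theta>$2 - \<theta>$3 + 2 * h * (p + q - 1))"

text \<open>Up to first order in h the three numerators are \<open>n + 2 * h\<close>,
  \<open>\<beta> + 2 * h * (q - 1)\<close> and \<open>\<alpha> + 2 * h * (p - 1)\<close>. They add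
  up to the denominator, which leaves 1 and a multiple of \<open>h\<^sup>2\<close>.\<close>

lemma ratio_moment_line:
  fixes \<theta> :: "real ^ 3" and p q h :: real
  assumes "\<theta> \<in> Theta"
    and pos: "0 < \<theta>$1 + 2 * h * p" "0 < \<theta>$2 + 2 * h * q"
      "0 < \<theta>$1 + \<theta>$2 - \<theta>$3 + 2 * h * (p + q - 1)"
    and \<theta>': "\<theta>' $ 1 = \<theta> $ 1 + h * p" "\<theta>' $ 2 = \<theta> $ 2 + h * q" "\<theta>' $ 3 = \<theta> $ 3 + h"
  shows "ratio_moment \<theta> \<theta>' = 1 + h\<^sup>2 * line_excess \<theta> p q h"
proof -
  define a b n \<alpha> \<beta> where defs: "a = \<theta> $ 1" "b = \<theta> $ 2" "n = \<theta> $ 3" "\<alpha> = a - n" "\<beta> = b - n"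
  have nz: "0 < a" "0 < b" "0 < n" "0 < \<alpha>" "0 < \<beta>"
    using assms(1) by (auto simp: Theta_def defs)
  \<comment> \<open>Serves both triangles, with \<open>(x, y, r, s)\<close> equal to
    \<open>(a, \<beta>, p, q - 1)\<close> and \<open>(b, \<alpha>, q, p - 1)\<close>. The identity
    \<open>(x + h * r)\<^sup>2 = x * (x + 2 * h * r) + h\<^sup>2 * r\<^sup>2\<close> isolates the
    quadratic excess.\<close>
  have one: "((x + h * r) * (y + h * s))\<^sup>2 / (x * y) / (x + 2 * h * r) =
      y + 2 * h * s + h\<^sup>2 * (s\<^sup>2 / y + r\<^sup>2 * (y + h * s)\<^sup>2 / (y * x * (x + 2 * h * r)))"
    if "0 < x" "0 < y" "0 < x + 2 * h * r" for x y r s :: real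
  proof -
    have "((x + h * r) * (y + h * s))\<^sup>2 / (x * y) / (x + 2 * h * r) =
        (y + h * s)\<^sup>2 / y * ((x + h * r)\<^sup>2 / (x * (x + 2 * h * r)))"
      by (simp add: power_mult_distrib mult_ac)
    also have "(x + h * r)\<^sup>2 / (x * (x + 2 * h * r)) = 1 + h\<^sup>2 * r\<^sup>2 / (x * (x + 2 * h * r))"
      using that by (simp add: divide_simps) (simp add: algebra_simps power2_eq_square)
    also have "(y + h * s)\<^sup>2 / y = y + 2 * h * s + h\<^sup>2 * s\<^sup>2 / y"
      using that by (simp add: divide_simps) (simp add: algebra_simps power2_eq_square)
    finally show ?thesis
      using that by (simp add: divide_simps) (simp add: algebra_simps power2_eq_square)
  qed
  have n2: "(n + h)\<^sup>2 / n = n + 2 * h + h\<^sup>2 * (1 / n)"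
    using nz by (simp add: divide_simps) (simp add: algebra_simps power2_eq_square)
  define u where "u = a + b - n + 2 * h * (p + q - 1)"
  have u: "0 < u" using pos by (simp add: u_def defs)
  let ?R = "1 / n + (q - 1)\<^sup>2 / \<beta> + (p - 1)\<^sup>2 / \<alpha>
      + p\<^sup>2 * (\<beta> + h * (q - 1))\<^sup>2 / (\<beta> * a * (a + 2 * h * p))
      + q\<^sup>2 * (\<alpha> + h * (p - 1))\<^sup>2 / (\<alpha> * b * (b + 2 * h * q))"
  have "ratio_moment \<theta> \<theta>' = ((n + h)\<^sup>2 / n
      + ((a + h * p) * (\<beta> + h * (q - 1)))\<^sup>2 / (a * \<beta>) / (a + 2 * h * p)
      + ((b + h * q) * (\<alpha> + h * (p - 1)))\<^sup>2 / (b * \<alpha>) / (b + 2 * h * q)) / u"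
  proof -
    have "2 * (a + h * p) - a = a + 2 * h * p" "2 * (b + h * q) - b = b + 2 * h * q"
      "b + h * q - (n + h) = \<beta> + h * (q - 1)" "a + h * p - (n + h) = \<alpha> + h * (p - 1)"
      "2 * (a + h * p + (b + h * q) - (n + h)) - (a + b - n) = u"
      by (simp_all add: defs u_def algebra_simps)
    then show ?thesis
      unfolding ratio_moment_def \<theta>' defs(1-3)[symmetric] by (simp only: defs(4,5)[symmetric])
  qed
  also have "\<dots> = (u + h\<^sup>2 * ?R) / u"
    using nz pos by (subst (1 2) one) (simp_all only: n2 defs(1,2) u_def, simp_all add: defs algebra_simps)
  also have "\<dots> = 1 + h\<^sup>2 * (?R / u)"
    using u add_divide_distrib[of u _ u] by simp
  also have "?R / u = line_excess \<theta> p q h"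
    by (simp add: line_excess_def u_def defs)
  finally show ?thesis .
qed

text \<open>At \<open>h = 0\<close> the dependence on p and q separates. The chosen values minimise
  \<open>(p - 1)\<^sup>2 / \<alpha> + p\<^sup>2 * \<beta> / a\<^sup>2\<close> and its counterpart
  for q; the minima are \<open>\<beta> / (a\<^sup>2 + \<alpha> * \<beta>)\<close> and
  \<open>\<alpha> / (b\<^sup>2 + \<alpha> * \<beta>)\<close>.\<close>

lemma line_excess_0:
  assumes "\<theta> \<in> Theta"
  defines "a \<equiv> \<theta> $ 1" and "b \<equiv> \<theta> $ 2" and "n \<equiv> \<theta> $ 3"
  defines "\<alpha> \<equiv> a - n" and "\<beta> \<equiv> b - n" and "u \<equiv> a + b - n"
  shows "line_excess \<theta> (a\<^sup>2 / (a\<^sup>2 + \<alpha> * \<beta>)) (b\<^sup>2 / (b\<^sup>2 + \<alpha> * \<beta>)) 0 =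
    (1 / n + \<beta> / (a\<^sup>2 + \<alpha> * \<beta>) + \<alpha> / (b\<^sup>2 + \<alpha> * \<beta>)) / u"
proof -
  have pos: "0 < a" "0 < b" "0 < n" "0 < \<alpha>" "0 < \<beta>"
    using assms by (auto simp: Theta_def)
  have one: "(x\<^sup>2 / (x\<^sup>2 + c) - 1)\<^sup>2 / y + (x\<^sup>2 / (x\<^sup>2 + c))\<^sup>2 * z\<^sup>2 / (z * x * x) = z / (x\<^sup>2 + c)"
    if "0 < x" "0 < y" "0 < z" "c = y * z" for x y z c :: real
  proof -
    define d where "d = x\<^sup>2 + c"
    have d: "0 < d" using that by (simp add: d_def add_nonneg_pos)
    have "x\<^sup>2 / d - 1 = - (y * z / d)"
    proof -
      have "x\<^sup>2 = d - y * z" by (simp add: d_def that)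
      then show ?thesis using d by (simp add: diff_divide_distrib)
    qed
    then have "(x\<^sup>2 / d - 1)\<^sup>2 / y = y * z\<^sup>2 / d\<^sup>2"
      using that by (simp add: power_mult_distrib power_divide power2_eq_square)
    moreover have "(x\<^sup>2 / d)\<^sup>2 * z\<^sup>2 / (z * x * x) = x\<^sup>2 * z / d\<^sup>2"
      using that by (simp add: power2_eq_square)
    moreover have "y * z\<^sup>2 / d\<^sup>2 + x\<^sup>2 * z / d\<^sup>2 = z * d / d\<^sup>2"
      using that by (simp add: add_divide_distrib[symmetric] d_def power2_eq_square algebra_simps)
    ultimately show ?thesis
      using d unfolding d_def[symmetric] by (simp add: power2_eq_square)
  qed
  show ?thesis
    using one[of a \<alpha> \<beta> "\<alpha> * \<beta>"] one[of b \<beta> \<alpha> "\<alpha> * \<beta>"] pos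
    unfolding line_excess_def a_def[symmetric] b_def[symmetric] n_def[symmetric] \<alpha>_def[symmetric]
      \<beta>_def[symmetric]
    by (simp add: u_def mult.commute)
qed

lemma variance_bound_line:
  assumes \<theta>: "\<theta> \<in> Theta" and T: "unbiased_n m T" and V: "Var m \<theta> T = ennreal V" "0 \<le> V"
  shows "1 \<le> V * (real m * line_excess \<theta> p q 0)"
proof -
  define \<theta>' where "\<theta>' h = \<theta> + h *\<^sub>R (p *\<^sub>R axis 1 1 + q *\<^sub>R axis 2 1 + axis 3 1)" for h
  have \<theta>'_nth: "\<theta>' h $ 1 = \<theta> $ 1 + h * p" "\<theta>' h $ 2 = \<theta> $ 2 + h * q" "\<theta>' h $ 3 = \<theta> $ 3 + h" for h
    by (simp_all add: \<theta>'_def axis_def)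
  define K where "K h = 1 + h\<^sup>2 * line_excess \<theta> p q h" for h
  have pos: "0 < \<theta>$3" "0 < \<theta>$1" "0 < \<theta>$2" "0 < \<theta>$1 - \<theta>$3" "0 < \<theta>$2 - \<theta>$3"
    "0 < \<theta>$1 + \<theta>$2 - \<theta>$3"
    using \<theta> by (auto simp: Theta_def)
  have lim: "(line_excess \<theta> p q \<longlongrightarrow> line_excess \<theta> p q 0) (at 0)"
    unfolding line_excess_def by (rule tendsto_eq_intros refl | use pos in force)+
  \<comment> \<open>The side conditions on the line are open and hold at \<open>h = 0\<close>, so
    they persist for small h.\<close>
  have "(\<theta>' \<longlongrightarrow> \<theta>' 0) (at 0)" "((\<lambda>h. \<theta>$1 + 2 * h * p) \<longlongrightarrow> \<theta>$1 + 2 * 0 * p) (at 0)"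
    "((\<lambda>h. \<theta>$2 + 2 * h * q) \<longlongrightarrow> \<theta>$2 + 2 * 0 * q) (at 0)"
    "((\<lambda>h. \<theta>$1 + \<theta>$2 - \<theta>$3 + 2 * h * (p + q - 1)) \<longlongrightarrow> \<theta>$1 + \<theta>$2 - \<theta>$3 + 2 * 0 * (p + q - 1)) (at 0)"
    unfolding \<theta>'_def by (intro tendsto_intros)+
  moreover have \<theta>'_0: "\<theta>' 0 = \<theta>" by (simp add: \<theta>'_def)
  ultimately have "\<forall>\<^sub>F h in at 0. \<theta>' h \<in> Theta" "\<forall>\<^sub>F h in at 0. 0 < \<theta>$1 + 2 * h * p"
    "\<forall>\<^sub>F h in at 0. 0 < \<theta>$2 + 2 * h * q"
    "\<forall>\<^sub>F h in at 0. 0 < \<theta>$1 + \<theta>$2 - \<theta>$3 + 2 * h * (p + q - 1)"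
    using pos \<theta> open_Theta by (auto intro: order_tendstoD topological_tendstoD)
  then have "\<forall>\<^sub>F h in at 0. 1 \<le> V * (line_excess \<theta> p q h * (\<Sum>i<m. K h ^ i))"
    using eventually_neq_at_within[of 0 0 UNIV]
  proof eventually_elim
    case (elim h)
    have K: "ratio_moment \<theta> (\<theta>' h) = K h"
      unfolding K_def by (rule ratio_moment_line) (use elim \<theta> \<theta>'_nth in auto)
    have "(\<theta>' h $ 3 - \<theta> $ 3)\<^sup>2 \<le> V * (ratio_moment \<theta> (\<theta>' h) ^ m - 1)"
      by (rule chapman_robbins_model[OF \<theta> elim(1) _ _ _ T V])
        (use elim in \<open>simp_all add: \<theta>'_nth algebra_simps\<close>)
    \<comment> \<open>The geometric sum extracts the factor
      \<open>K h - 1 = h\<^sup>2 * line_excess \<theta> p q h\<close>, so that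
      \<open>h\<^sup>2\<close> cancels for nonzero h.\<close>
    also have "\<dots> = V * ((K h - 1) * (\<Sum>i<m. K h ^ i))"
      unfolding K power_diff_1_eq ..
    finally have "h\<^sup>2 * 1 \<le> h\<^sup>2 * (V * (line_excess \<theta> p q h * (\<Sum>i<m. K h ^ i)))"
      by (simp add: \<theta>'_nth K_def ac_simps)
    then show ?case using elim by (subst (asm) mult_le_cancel_left_pos) auto
  qed
  \<comment> \<open>Every \<open>K h\<close> tends to 1, so the geometric sum tends to m.\<close>
  moreover have "((\<lambda>h. V * (line_excess \<theta> p q h * (\<Sum>i<m. K h ^ i))) \<longlongrightarrow>
      V * (line_excess \<theta> p q 0 * (\<Sum>i<m. (1 + 0\<^sup>2 * line_excess \<theta> p q 0) ^ i))) (at 0)"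
    unfolding K_def by (intro tendsto_intros lim)
  ultimately have "1 \<le> V * (line_excess \<theta> p q 0 * (\<Sum>i<m. (1 + 0\<^sup>2 * line_excess \<theta> p q 0) ^ i))"
    by (intro tendsto_lowerbound) auto
  then show ?thesis by (simp add: mult.commute)
qed

section \<open>Inversion of the Fisher matrix and conclusion\<close>

text \<open>A vector sent to the j-th basis vector is the j-th column of the inverse, so one column
  can be found without inverting the whole matrix.\<close>

lemma matrix_inv_nth:
  fixes F :: "real ^ 'n ^ 'n"
  assumes "invertible F" "F *v v = axis j 1"
  shows "matrix_inv F $ i $ j = v $ i"
proof -
  have "matrix_inv F ** F = mat 1"
    using someI_ex[OF assms(1)[unfolded invertible_def]] by (auto simp: matrix_inv_def)
  then have "v = matrix_inv F *v axis j 1"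
    by (metis assms(2) matrix_vector_mul_assoc matrix_vector_mul_lid)
  then show ?thesis
    by (simp add: matrix_vector_mult_basis column_def)
qed

text \<open>Invertibility is part of the conclusion because \<open>matrix_inv\<close> is defined by
  choice and is a genuine inverse only for invertible matrices.\<close>

theorem corollary2:
  fixes m :: nat and nhat :: "(nat \<Rightarrow> real \<times> real) \<Rightarrow> real"
    and \<theta> :: "real ^ 3" and a b n \<alpha> \<beta> u :: real
  assumes "m \<ge> 1"
    and "estimator m nhat"
    and "unbiased_n m nhat"
    and "\<theta> \<in> Theta"
  defines "a \<equiv> \<theta> $ 1" and "b \<equiv> \<theta> $ 2" and "n \<equiv> \<theta> $ 3"
  defines "\<alpha> \<equiv> a - n" and "\<beta> \<equiv> b - n" and "u \<equiv> a + b - n"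
  shows "Var m \<theta> nhat \<ge> ennreal (matrix_inv (fisher m \<theta>) $ 3 $ 3) \<and>
    invertible (fisher m \<theta>) \<and>
    matrix_inv (fisher m \<theta>) $ 3 $ 3 =
      n * u / real m *
      ((b\<^sup>2 + \<alpha> * \<beta>) * (a\<^sup>2 + \<alpha> * \<beta>) /
       (\<alpha> * n * (a\<^sup>2 + \<alpha> * \<beta>) + \<beta> * n * (b\<^sup>2 + \<alpha> * \<beta>) + (a\<^sup>2 + \<alpha> * \<beta>) * (b\<^sup>2 + \<alpha> * \<beta>)))"
proof -
  \<comment> \<open>\<open>p\<close> and \<open>q\<close> are the minimisers of
    \<open>line_excess_0\<close>, \<open>W / u\<close> is the minimum, and \<open>r\<close> is the
    candidate for the (3,3) entry of the inverse.\<close>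
  define p q where "p = a\<^sup>2 / (a\<^sup>2 + \<alpha> * \<beta>)" and "q = b\<^sup>2 / (b\<^sup>2 + \<alpha> * \<beta>)"
  define W where "W = 1 / n + \<beta> / (a\<^sup>2 + \<alpha> * \<beta>) + \<alpha> / (b\<^sup>2 + \<alpha> * \<beta>)"
  define r where "r = u / (real m * W)"
  have pos: "0 < a" "0 < b" "0 < n" "0 < \<alpha>" "0 < \<beta>" "0 < u" "0 < real m"
    using assms by (auto simp: Theta_def)
  then have D: "0 < a\<^sup>2 + \<alpha> * \<beta>" "0 < b\<^sup>2 + \<alpha> * \<beta>" by (simp_all add: add_pos_pos)
  with pos have W: "0 < W" by (simp add: W_def add_pos_pos)
  let ?e = "\<lambda>i k. (axis k 1 :: real ^ 3) $ i"
  have entry: "fisher m \<theta> $ i $ j = real m *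
      (?e i 3 * ?e j 3 / n\<^sup>2 * (n / u)
        + (?e i 1 * ?e j 1 / a\<^sup>2 + (?e i 2 - ?e i 3) * (?e j 2 - ?e j 3) / \<beta>\<^sup>2) * (\<beta> / u)
        + (?e i 2 * ?e j 2 / b\<^sup>2 + (?e i 1 - ?e i 3) * (?e j 1 - ?e j 3) / \<alpha>\<^sup>2) * (\<alpha> / u))" for i j
    unfolding fisher_entry[OF assms(4)]
      has_bochner_integral_integral_eq[OF expectation_hess[OF assms(4), of i j]]
    by (simp only: vector_minus_component mult_minus_right minus_minus a_def b_def n_def \<alpha>_def \<beta>_def u_def)
  define k A B C where "k = real m / u" and "A = \<beta> / a\<^sup>2 + 1 / \<alpha>" and "B = \<alpha> / b\<^sup>2 + 1 / \<beta>"
    and "C = 1 / n + 1 / \<alpha> + 1 / \<beta>"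
  note kABC = this
  have entries:
    "fisher m \<theta> $ 1 $ 1 = k * A" "fisher m \<theta> $ 2 $ 2 = k * B" "fisher m \<theta> $ 3 $ 3 = k * C"
    "fisher m \<theta> $ 1 $ 2 = 0" "fisher m \<theta> $ 2 $ 1 = 0"
    "fisher m \<theta> $ 1 $ 3 = - (k * (1 / \<alpha>))" "fisher m \<theta> $ 3 $ 1 = - (k * (1 / \<alpha>))"
    "fisher m \<theta> $ 2 $ 3 = - (k * (1 / \<beta>))" "fisher m \<theta> $ 3 $ 2 = - (k * (1 / \<beta>))"
    unfolding entry kABC using pos
    by (simp_all add: axis_def power2_eq_square divide_simps) (simp add: algebra_simps)
  \<comment> \<open>These identities say that the first two rows of the Fisher matrix annihilate (p,
    q, 1).\<close>
  have pq: "1 / \<alpha> = A * p" "1 / \<beta> = B * q"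
    using pos D unfolding p_def q_def kABC by (simp_all add: divide_simps)
  have "1 - p = \<alpha> * \<beta> / (a\<^sup>2 + \<alpha> * \<beta>)" "1 - q = \<alpha> * \<beta> / (b\<^sup>2 + \<alpha> * \<beta>)"
    using D unfolding p_def q_def by (simp_all add: divide_simps)
  then have "1 / n + (1 - p) / \<alpha> + (1 - q) / \<beta> = W"
    using pos unfolding W_def by simp
  \<comment> \<open>After division by \<open>k\<close>, \<open>W\<close> is the Schur complement of
    the upper left block \<open>diag(A, B)\<close>, whence the factorized determinant.\<close>
  then have C: "C = W + p * (1 / \<alpha>) + q * (1 / \<beta>)"
    by (simp add: C_def diff_divide_distrib)
  have "det (fisher m \<theta>) = k ^ 3 * (A * B * W)"
    unfolding det_3 entries C pq by (simp add: algebra_simps power3_eq_cube)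
  also have "\<dots> > 0" using pos W by (simp add: kABC add_pos_pos)
  finally have inv: "invertible (fisher m \<theta>)" by (simp add: invertible_det_nz)
  \<comment> \<open>The vector (p, q, 1) is sent to \<open>k * W\<close> times the third basis
    vector, and \<open>r\<close> is the reciprocal of \<open>k * W\<close>.\<close>
  have "k * r * W = 1" using pos W by (simp add: r_def k_def)
  then have "fisher m \<theta> *v (r *\<^sub>R (p *\<^sub>R axis 1 1 + q *\<^sub>R axis 2 1 + axis 3 1)) = axis 3 1"
    unfolding vec_eq_iff forall_3 matrix_vector_mult_def sum_3 vec_lambda_beta entries C pq
    by (simp add: axis_def algebra_simps)
  from matrix_inv_nth[OF inv this, of 3] have inv33: "matrix_inv (fisher m \<theta>) $ 3 $ 3 = r"
    by (simp add: axis_def)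
  have "r = n * u / real m *
      ((b\<^sup>2 + \<alpha> * \<beta>) * (a\<^sup>2 + \<alpha> * \<beta>) /
       (\<alpha> * n * (a\<^sup>2 + \<alpha> * \<beta>) + \<beta> * n * (b\<^sup>2 + \<alpha> * \<beta>) + (a\<^sup>2 + \<alpha> * \<beta>) * (b\<^sup>2 + \<alpha> * \<beta>)))"
  proof -
    have "W = (\<alpha> * n * (a\<^sup>2 + \<alpha> * \<beta>) + \<beta> * n * (b\<^sup>2 + \<alpha> * \<beta>) + (a\<^sup>2 + \<alpha> * \<beta>) * (b\<^sup>2 + \<alpha> * \<beta>)) /
        (n * ((b\<^sup>2 + \<alpha> * \<beta>) * (a\<^sup>2 + \<alpha> * \<beta>)))"
      unfolding W_def using pos D by (simp add: divide_simps) (simp add: algebra_simps)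
    then show ?thesis by (simp add: r_def)
  qed
  moreover have "ennreal r \<le> Var m \<theta> nhat"
  \<comment> \<open>An infinite variance satisfies the bound trivially; a finite one is a real
    \<open>V\<close> to which the limiting inequality applies.\<close>
  proof (cases "Var m \<theta> nhat")
    case (real V)
    have "line_excess \<theta> p q 0 = W / u"
      using line_excess_0[OF assms(4)] unfolding W_def p_def q_def \<alpha>_def \<beta>_def u_def a_def b_def n_def .
    with variance_bound_line[OF assms(4,3) real(2,1), of p q] have "1 \<le> V * (real m * (W / u))" by simp
    then have "r \<le> V" using pos W by (simp add: r_def field_simps)
    with real show ?thesis by (simp add: ennreal_leI)
  qed simp
  ultimately show ?thesis using inv inv33 by simp
qed

end
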